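(* Let $T$ be a left-invariant $(0,2)$ tensor field on $H_3$. There exist a left-invariant Riemannian metric $g$ and a constant $c>0$ such that $\mathrm{Ric}(g)=cT$ if and only if $T$ is diagonalisable with $T=\mathrm{diag}(T_1,T_2,T_3)$ in a basis $V_1,V_2,V_3$ of the Lie algebra satisfying $[V_i,V_j]=\sum_{k=1}^3\epsilon_{ijk}\lambda_kV_k$ with $\lambda_1=2$, $\lambda_2=\lambda_3=0$, and $T_1>0$, $T_2<0$ and $T_3<0$. The pair $(g,c)$ is unique.
   Context: $H_3$ (the Heisenberg group) denotes the three-dimensional unimodular Lie group whose Lie algebra has a basis with $[V_i,V_j]=\sum_k\epsilon_{ijk}\lambda_kV_k$, $(\lambda_1,\lambda_2,\lambda_3)=(2,0,0)$, where $\epsilon_{ijk}$ is the Levi-Civita symbol. Left-invariant tensor fields are identified with tensors on the Lie algebra. $\mathrm{Ric}(g)$ is the Ricci curvature $(0,2)$-tensor of $g$. $T=\mathrm{diag}(T_1,T_2,T_3)$ in the basis $V_1,V_2,V_3$ means $T(V_i,V_i)=T_i$ and $T(V_i,V_j)=0$ for $i\neq j$. Uniqueness of $(g,c)$ is understood up to scaling of $g$ (so "unique" means that any other solution $(\bar g,\bar c)$ has $\bar c=c$ and $\bar g$ a positive multiple of $g$). *)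

theory Defs
  imports "HOL-Analysis.Analysis"
begin

text \<open>
  Left-invariant objects on a Lie group are represented by the corresponding objects on its Lie
  algebra, a real vector space with a bracket \<open>br\<close>. No inner product on the underlying type is
  presupposed: the metric \<open>g\<close> is a separate argument.
\<close>

definition lie_bracket :: "('a::real_vector \<Rightarrow> 'a \<Rightarrow> 'a) \<Rightarrow> bool" where
  "lie_bracket br \<longleftrightarrow> bilinear br \<and> (\<forall>x. br x x = 0) \<and>
     (\<forall>x y z. br x (br y z) + br y (br z x) + br z (br x y) = 0)"

definition levi_civita_symbol :: "nat \<Rightarrow> nat \<Rightarrow> nat \<Rightarrow> real" where
  "levi_civita_symbol i j k =
     (if (i, j, k) \<in> {(1, 2, 3), (2, 3, 1), (3, 1, 2)} then 1
      else if (i, j, k) \<in> {(1, 3, 2), (3, 2, 1), (2, 1, 3)} then - 1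
      else 0)"

text \<open>Only the values of \<open>V\<close> and \<open>l\<close> at \<open>1\<close>, \<open>2\<close>, \<open>3\<close> matter.\<close>

definition basis_frame :: "(nat \<Rightarrow> 'a::real_vector) \<Rightarrow> bool" where
  "basis_frame V \<longleftrightarrow> inj_on V {1..3} \<and> independent (V ` {1..3}) \<and> span (V ` {1..3}) = UNIV"

definition milnor_frame ::
    "('a::real_vector \<Rightarrow> 'a \<Rightarrow> 'a) \<Rightarrow> (nat \<Rightarrow> real) \<Rightarrow> (nat \<Rightarrow> 'a) \<Rightarrow> bool" where
  "milnor_frame br l V \<longleftrightarrow> basis_frame V \<and>
     (\<forall>i\<in>{1..3}. \<forall>j\<in>{1..3}.
        br (V i) (V j) = (\<Sum>k=1..3. (levi_civita_symbol i j k * l k) *\<^sub>R V k))"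

definition heisenberg_constants :: "nat \<Rightarrow> real" where
  "heisenberg_constants k = (if k = 1 then 2 else 0)"

definition heisenberg_lie_algebra :: "('a::real_vector \<Rightarrow> 'a \<Rightarrow> 'a) \<Rightarrow> bool" where
  "heisenberg_lie_algebra br \<longleftrightarrow>
     lie_bracket br \<and> (\<exists>V. milnor_frame br heisenberg_constants V)"

definition left_invariant_metric :: "('a::real_vector \<Rightarrow> 'a \<Rightarrow> real) \<Rightarrow> bool" where
  "left_invariant_metric g \<longleftrightarrow>
     bilinear g \<and> (\<forall>x y. g x y = g y x) \<and> (\<forall>x. x \<noteq> 0 \<longrightarrow> g x x > 0)"

text \<open>
  The Levi-Civita connection restricted to left-invariant fields. It is torsion free and metric;
  the term \<open>X (g Y Z)\<close> of metric compatibility vanishes because \<open>g Y Z\<close> is constant for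
  left-invariant \<open>Y\<close>, \<open>Z\<close>. On a finite-dimensional algebra with an inner product \<open>g\<close> the
  connection exists and is unique.
\<close>

definition is_levi_civita ::
    "('a::real_vector \<Rightarrow> 'a \<Rightarrow> 'a) \<Rightarrow> ('a \<Rightarrow> 'a \<Rightarrow> real) \<Rightarrow> ('a \<Rightarrow> 'a \<Rightarrow> 'a) \<Rightarrow> bool" where
  "is_levi_civita br g N \<longleftrightarrow> bilinear N \<and>
     (\<forall>x y. N x y - N y x = br x y) \<and>
     (\<forall>x y z. g (N x y) z + g y (N x z) = 0)"

definition levi_civita ::
    "('a::real_vector \<Rightarrow> 'a \<Rightarrow> 'a) \<Rightarrow> ('a \<Rightarrow> 'a \<Rightarrow> real) \<Rightarrow> 'a \<Rightarrow> 'a \<Rightarrow> 'a" where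
  "levi_civita br g = (THE N. is_levi_civita br g N)"

definition riemann ::
    "('a::real_vector \<Rightarrow> 'a \<Rightarrow> 'a) \<Rightarrow> ('a \<Rightarrow> 'a \<Rightarrow> real) \<Rightarrow> 'a \<Rightarrow> 'a \<Rightarrow> 'a \<Rightarrow> 'a" where
  "riemann br g x y z =
     (let N = levi_civita br g in N x (N y z) - N y (N x z) - N (br x y) z)"

text \<open>\<open>extend_basis {}\<close> is some basis of the whole space; the trace does not depend on which.\<close>

definition endo_trace :: "('a::real_vector \<Rightarrow> 'a) \<Rightarrow> real" where
  "endo_trace f = (let B = extend_basis {} in \<Sum>b\<in>B. representation B (f b) b)"

definition ricci ::
    "('a::real_vector \<Rightarrow> 'a \<Rightarrow> 'a) \<Rightarrow> ('a \<Rightarrow> 'a \<Rightarrow> real) \<Rightarrow> 'a \<Rightarrow> 'a \<Rightarrow> real" where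
  "ricci br g y z = endo_trace (\<lambda>x. riemann br g x y z)"

definition diagonal_in ::
    "('a::real_vector \<Rightarrow> 'a \<Rightarrow> real) \<Rightarrow> (nat \<Rightarrow> 'a) \<Rightarrow> (nat \<Rightarrow> real) \<Rightarrow> bool" where
  "diagonal_in T V t \<longleftrightarrow>
     (\<forall>i\<in>{1..3}. \<forall>j\<in>{1..3}. T (V i) (V j) = (if i = j then t i else 0))"

definition prescribed_ricci ::
    "('a::real_vector \<Rightarrow> 'a \<Rightarrow> 'a) \<Rightarrow> ('a \<Rightarrow> 'a \<Rightarrow> real) \<Rightarrow> ('a \<Rightarrow> 'a \<Rightarrow> real) \<Rightarrow> real \<Rightarrow> bool" where
  "prescribed_ricci br T g c \<longleftrightarrow>
     left_invariant_metric g \<and> c > 0 \<and> (\<forall>x y. ricci br g x y = c * T x y)"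

end

theory Submission
  imports Defs
begin

text \<open>
  Write \<open>z = V 1\<close> for a generator of the centre. A Gram-Schmidt step along \<open>V 1\<close>, \<open>V 2\<close>, \<open>V 3\<close> changes
  \<open>V 2\<close> by a central vector and \<open>V 3\<close> by a central vector and a multiple of \<open>V 2\<close>, which does not
  affect \<open>br (V 2) (V 3)\<close>; so every metric \<open>g\<close> is diagonal, with entries \<open>a 1\<close>, \<open>a 2\<close>, \<open>a 3\<close>, in some Milnor
  frame with the same \<open>z\<close> (\<open>orthogonal_milnor_frame\<close>). In such a frame the Levi-Civita connection
  can be written down, and tracing its curvature gives (\<open>ricci_heisenberg\<close>)
  \<open>Ric(x, y) = q (2 g(x, z) g(y, z) / g(z, z) - g(x, y))\<close> with \<open>q = 2 a\<^sub>1 / (a\<^sub>2 a\<^sub>3) > 0\<close>.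
  Up to the factor \<open>q\<close>, the Ricci form is thus \<open>g\<close> with its sign reversed on the orthogonal complement
  of the centre. This gives the signature \<open>(+,-,-)\<close> of \<open>T\<close> when \<open>Ric(g) = c T\<close>.

  Reversing a sign twice changes nothing, so the passage from \<open>g\<close> to \<open>T\<close> can be undone by the same
  formula. For \<open>T\<close> of that signature, \<open>g(x, y) = 2 T(x, z) T(y, z) / T(z, z) - T(x, y)\<close> is a metric
  that solves the problem. For an arbitrary solution, the same formula applied to \<open>T\<close> returns a
  positive multiple of the metric, which is therefore determined up to scale; and since \<open>Ric\<close> is unchanged by scaling
  (\<open>ricci_scale\<close>), \<open>T(z, z) > 0\<close> then determines \<open>c\<close>.
\<close>

section \<open>Bilinear forms, frames and traces\<close>

\<comment> \<open>Otherwise \<open>V 1\<close> is rewritten to \<open>V (Suc 0)\<close> and facts about \<open>V 1\<close> no longer match.\<close>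
declare One_nat_def [simp del]

lemma bilinear_simps:
  assumes "bilinear h"
  shows "h (x + y) z = h x z + h y z" "h x (y + z) = h x y + h x z"
    "h (x - y) z = h x z - h y z" "h x (y - z) = h x y - h x z"
    "h (c *\<^sub>R x) z = c *\<^sub>R h x z" "h x (c *\<^sub>R z) = c *\<^sub>R h x z"
    "h 0 z = 0" "h x 0 = 0" "h (- x) z = - h x z" "h x (- z) = - h x z"
  using assms
  by (simp_all add: bilinear_ladd bilinear_radd bilinear_lsub bilinear_rsub bilinear_lmul
      bilinear_rmul bilinear_lzero bilinear_rzero bilinear_lneg bilinear_rneg)

lemma atLeastAtMost_1_3: "{1..3::nat} = {1, 2, 3}"
  by auto

lemma basis_frame_expansion:
  assumes "basis_frame V"
  obtains p q r where "x = p *\<^sub>R V 1 + q *\<^sub>R V 2 + r *\<^sub>R V 3"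
proof -
  have "x \<in> span {V 1, V 2, V 3}"
    using assms by (simp add: basis_frame_def atLeastAtMost_1_3)
  then obtain p q r where "x - p *\<^sub>R V 1 - q *\<^sub>R V 2 - r *\<^sub>R V 3 = 0"
    by (auto simp: span_insert)
  then have "x = p *\<^sub>R V 1 + q *\<^sub>R V 2 + r *\<^sub>R V 3"
    by (simp add: algebra_simps)
  then show ?thesis by (rule that)
qed

lemma basis_frame_nonzero:
  assumes "basis_frame V" "i \<in> {1..3}"
  shows "V i \<noteq> 0"
  using assms dependent_zero unfolding basis_frame_def by (metis imageI)

lemma metric_diagonal_pos:
  assumes "left_invariant_metric g" "basis_frame V" "diagonal_in g V a" "i \<in> {1..3}"
  shows "a i > 0"
proof -
  have "g (V i) (V i) = a i" "g (V i) (V i) > 0"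
    using assms basis_frame_nonzero[of V i] by (auto simp: diagonal_in_def left_invariant_metric_def)
  then show ?thesis by simp
qed

text \<open>
  Three vectors that span a three-dimensional space are distinct and independent, so to change
  frames it is enough to recover the old frame from the new one.
\<close>

lemma basis_frame_transfer:
  assumes V: "basis_frame V" and VW: "\<And>i. i \<in> {1..3} \<Longrightarrow> V i \<in> span (W ` {1..3})"
  shows "basis_frame W"
proof -
  let ?B = "W ` {1..3}"
  have "UNIV = span (V ` {1..3})"
    using V by (simp add: basis_frame_def)
  also have "\<dots> \<subseteq> span ?B"
    using VW by (intro span_minimal) auto
  finally have span: "span ?B = UNIV" by auto
  have "card (V ` {1..3}) = 3"
    using V by (simp add: basis_frame_def card_image)
  then have dim: "dim (UNIV :: 'a set) = 3"
    using V dim_eq_card[of "V ` {1..3}" UNIV] by (simp add: basis_frame_def)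
  have "card ?B \<le> 3"
    using card_image_le[of "{1..3::nat}" W] by simp
  moreover have "3 \<le> card ?B"
    using dim_le_card[of UNIV ?B] span dim by simp
  ultimately have card: "card ?B = 3" by simp
  have "inj_on W {1..3}"
    by (rule eq_card_imp_inj_on) (simp_all add: card)
  moreover have "independent ?B"
  proof -
    obtain C where C: "C \<subseteq> ?B" "independent C" "?B \<subseteq> span C"
      using maximal_independent_subset[of ?B] by blast
    then have "span C = UNIV"
      using span span_minimal[OF C(3) subspace_span] by auto
    then have "card C = card ?B"
      using C(2) dim card dim_eq_card[of C UNIV] by simp
    then have "C = ?B"
      using C(1) by (intro card_subset_eq) auto
    then show ?thesis using C(2) by simp
  qed
  ultimately show ?thesis
    using span by (simp add: basis_frame_def)
qed

text \<open>
  The trace is defined through an unspecified basis \<open>B\<close>; this replaces it by a family of one's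
  choice. Expanding each \<open>f b\<close> and exchanging the two sums, the inner sum reassembles \<open>e i\<close> from its
  coordinates in \<open>B\<close>.
\<close>

lemma endo_trace_eq_sum:
  fixes f :: "'a::real_vector \<Rightarrow> 'a" and e :: "'i \<Rightarrow> 'a" and co :: "'i \<Rightarrow> 'a \<Rightarrow> real"
  assumes I: "finite I" and f: "linear f" and co: "\<And>i. i \<in> I \<Longrightarrow> linear (co i)"
    and expand: "\<And>x. x = (\<Sum>i\<in>I. co i x *\<^sub>R e i)"
  shows "endo_trace f = (\<Sum>i\<in>I. co i (f (e i)))"
proof -
  define B where "B = extend_basis ({} :: 'a set)"
  have B: "independent B" "span B = UNIV"
    by (simp_all add: B_def independent_extend_basis independent_empty)
  have "x \<in> span (e ` I)" for x
    by (subst expand[of x]) (intro span_sum span_scale span_base imageI)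
  then have "B \<subseteq> span (e ` I)" by blast
  with B(1) I have "finite B"
    using independent_span_bound[of "e ` I" B] by simp
  have rep: "(\<Sum>b\<in>B. representation B x b *\<^sub>R b) = x" for x
    using sum_representation_eq[OF B(1), of x B] B(2) \<open>finite B\<close> by simp
  have "representation B (f b) b = (\<Sum>i\<in>I. co i (f b) * representation B (e i) b)" for b
    by (subst expand[of "f b"]) (simp add: representation_sum representation_scale B)
  then have "endo_trace f = (\<Sum>b\<in>B. \<Sum>i\<in>I. co i (f b) * representation B (e i) b)"
    by (simp add: endo_trace_def B_def[symmetric])
  also have "\<dots> = (\<Sum>i\<in>I. \<Sum>b\<in>B. co i (f b) * representation B (e i) b)"
    by (rule sum.swap)
  also have "\<dots> = (\<Sum>i\<in>I. co i (f (\<Sum>b\<in>B. representation B (e i) b *\<^sub>R b)))"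
    by (intro sum.cong refl)
      (simp add: linear_sum[OF f] linear_sum[OF co] linear_cmul[OF f] linear_cmul[OF co] mult.commute)
  also have "\<dots> = (\<Sum>i\<in>I. co i (f (e i)))"
    by (simp add: rep)
  finally show ?thesis .
qed

section \<open>The Levi-Civita connection and scaling of the metric\<close>

text \<open>
  The right-hand side does not mention \<open>N\<close>, and \<open>g\<close> is nondegenerate: hence uniqueness of the
  connection. The formula is a signed sum of three cyclic instances of metric compatibility,
  with torsion-freeness used to exchange arguments.
\<close>

lemma koszul_formula:
  assumes N: "is_levi_civita br g N" and g: "left_invariant_metric g"
  shows "2 * g (N x y) z = g (br x y) z - g (br y z) x + g (br z x) y"
proof -
  have bil: "bilinear g" and sym: "\<And>x y. g x y = g y x"
    using g by (auto simp: left_invariant_metric_def)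
  have br: "br x y = N x y - N y x" for x y
    using N by (auto simp: is_levi_civita_def)
  have "g (N x y) z + g y (N x z) = 0" for x y z
    using N by (auto simp: is_levi_civita_def)
  from this[of x y z] this[of y z x] this[of z x y] show ?thesis
    by (simp add: br bilinear_simps[OF bil] sym[of y] sym[of z] sym[of x])
qed

lemma is_levi_civita_unique:
  assumes N: "is_levi_civita br g N" and N': "is_levi_civita br g N'" and g: "left_invariant_metric g"
  shows "N' = N"
proof (intro ext)
  fix x y
  let ?d = "N' x y - N x y"
  have "g (N' x y) z = g (N x y) z" for z
    using koszul_formula[OF N g, of x y z] koszul_formula[OF N' g, of x y z] by simp
  then have "g ?d ?d = 0"
    using g by (simp add: left_invariant_metric_def bilinear_simps)
  then show "N' x y = N x y"
    using g by (metis left_invariant_metric_def less_irrefl right_minus_eq)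
qed

lemma levi_civita_eq:
  assumes "is_levi_civita br g N" "left_invariant_metric g"
  shows "levi_civita br g = N"
  unfolding levi_civita_def using assms is_levi_civita_unique by (intro the_equality) blast+

text \<open>
  The defining conditions of the connection are homogeneous in \<open>g\<close>, and the curvature and its trace
  involve \<open>g\<close> only through the connection.
\<close>

lemma ricci_scale:
  assumes "s \<noteq> 0"
  shows "ricci br (\<lambda>x y. s * g x y) = ricci br g"
proof -
  have "s * a + s * b = 0 \<longleftrightarrow> a + b = 0" for a b :: real
    using assms by (metis distrib_left mult_eq_0_iff)
  then have "levi_civita br (\<lambda>x y. s * g x y) = levi_civita br g"
    by (simp add: levi_civita_def is_levi_civita_def)
  then show ?thesis
    by (simp add: ricci_def riemann_def Let_def fun_eq_iff)
qed

section \<open>Milnor frames of the Heisenberg algebra\<close>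

lemma lie_bracket_antisym:
  assumes "lie_bracket br"
  shows "br y x = - br x y"
proof -
  have bil: "bilinear br" and alt: "\<And>x. br x x = 0"
    using assms by (auto simp: lie_bracket_def)
  have "br (x + y) (x + y) = br x x + br y x + (br x y + br y y)"
    by (simp only: bilinear_simps[OF bil])
  then have "br y x + br x y = 0"
    by (simp add: alt)
  then show ?thesis by (simp only: eq_neg_iff_add_eq_0)
qed

lemma milnor_frame_heisenberg_iff:
  assumes "lie_bracket br"
  shows "milnor_frame br heisenberg_constants V \<longleftrightarrow>
    basis_frame V \<and> br (V 1) (V 2) = 0 \<and> br (V 1) (V 3) = 0 \<and> br (V 2) (V 3) = 2 *\<^sub>R V 1"
proof -
  have bil: "bilinear br" and alt: "\<And>x. br x x = 0"
    using assms by (auto simp: lie_bracket_def)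
  note anti = lie_bracket_antisym[OF assms]
  show ?thesis
    by (auto simp: milnor_frame_def atLeastAtMost_1_3 levi_civita_symbol_def
        heisenberg_constants_def alt anti[of "V 2" "V 1"] anti[of "V 3" "V 1"] anti[of "V 3" "V 2"])
qed

text \<open>
  Gram-Schmidt without normalisation: it subtracts from \<open>V 2\<close> a central vector and from \<open>V 3\<close>
  a central vector and a multiple of the new second vector. None of these affect the
  bracket relation \<open>[V 2, V 3] = 2 V 1\<close>. Keeping \<open>V 1\<close> fixed makes it possible to compare two
  metrics, whose orthogonal frames differ, through this one vector.
\<close>

lemma orthogonal_milnor_frame:
  assumes lie: "lie_bracket br" and V: "milnor_frame br heisenberg_constants V"
    and g: "left_invariant_metric g"
  obtains W a where "milnor_frame br heisenberg_constants W" "W 1 = V 1" "diagonal_in g W a"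
proof -
  have bil: "bilinear g" and sym: "\<And>x y. g x y = g y x" and pos: "\<And>x. x \<noteq> 0 \<Longrightarrow> g x x > 0"
    using g by (auto simp: left_invariant_metric_def)
  have bilbr: "bilinear br" and alt: "\<And>x. br x x = 0"
    using lie by (auto simp: lie_bracket_def)
  have V': "basis_frame V" "br (V 1) (V 2) = 0" "br (V 1) (V 3) = 0" "br (V 2) (V 3) = 2 *\<^sub>R V 1"
    using V by (simp_all add: milnor_frame_heisenberg_iff[OF lie])
  note anti = lie_bracket_antisym[OF lie]
  define proj where "proj u x = (g x u / g u u) *\<^sub>R u" for u x
  have orth: "g (x - proj u x) u = 0" for u x
    using pos[of u] by (cases "u = 0") (auto simp: proj_def bilinear_simps[OF bil])
  define w2 where "w2 = V 2 - proj (V 1) (V 2)"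
  define w3 where "w3 = V 3 - proj (V 1) (V 3) - proj w2 (V 3 - proj (V 1) (V 3))"
  define W where "W i = (if i = 1 then V 1 else if i = 2 then w2 else w3)" for i :: nat
  have W: "W 1 = V 1" "W 2 = w2" "W 3 = w3"
    by (simp_all add: W_def)
  have w21: "g w2 (V 1) = 0" unfolding w2_def by (rule orth)
  have w31: "g w3 (V 1) = 0"
    unfolding w3_def using orth[of "V 3" "V 1"] w21
    by (simp add: bilinear_simps[OF bil] proj_def[of w2])
  have w32: "g w3 w2 = 0" unfolding w3_def by (rule orth)
  have diag: "diagonal_in g W (\<lambda>i. g (W i) (W i))"
    by (auto simp: diagonal_in_def atLeastAtMost_1_3 W w21 w31 w32 sym[of "V 1" w2]
        sym[of "V 1" w3] sym[of w2 w3])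
  let ?S = "span (W ` {1..3})"
  have mem: "V 1 \<in> ?S" "w2 \<in> ?S" "w3 \<in> ?S"
    using span_base[OF imageI, of 1 "{1..3}" W] span_base[OF imageI, of 2 "{1..3}" W]
      span_base[OF imageI, of 3 "{1..3}" W] by (simp_all add: W)
  have p: "proj (V 1) x \<in> ?S" "proj w2 x \<in> ?S" for x
    unfolding proj_def by (intro span_scale mem)+
  have "V 2 \<in> ?S"
    using span_add[OF mem(2) p(1)[of "V 2"]] by (simp add: w2_def)
  moreover have "V 3 \<in> ?S"
    using span_add[OF span_add[OF mem(3) p(2)[of "V 3 - proj (V 1) (V 3)"]] p(1)[of "V 3"]]
    by (simp add: w3_def)
  ultimately have "basis_frame W"
    using mem(1) by (intro basis_frame_transfer[OF V'(1)]) (auto simp: atLeastAtMost_1_3)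
  then have "milnor_frame br heisenberg_constants W"
    by (simp add: milnor_frame_heisenberg_iff[OF lie] W w2_def w3_def proj_def
        bilinear_simps[OF bilbr] V' alt anti[of "V 2" "V 1"])
  then show ?thesis using W(1) diag by (rule that)
qed

section \<open>The Ricci curvature of a left-invariant metric\<close>

text \<open>
  In the orthogonal frame the curvature is an explicit polynomial in coordinates, and its trace is
  \<open>q (a 1 y\<^sub>1 z\<^sub>1 - a 2 y\<^sub>2 z\<^sub>2 - a 3 y\<^sub>3 z\<^sub>3)\<close> with \<open>q = 2 a 1 / (a 2 a 3)\<close>. The result is stated
  through \<open>g\<close> and \<open>V 1\<close> because that form refers to the rest of the frame only through \<open>q\<close>.
\<close>

lemma ricci_heisenberg:
  assumes lie: "lie_bracket br" and V: "milnor_frame br heisenberg_constants V"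
    and g: "left_invariant_metric g" and diag: "diagonal_in g V a"
  shows "ricci br g y z =
    2 * a 1 / (a 2 * a 3) * (2 * g y (V 1) * g z (V 1) / g (V 1) (V 1) - g y z)"
proof -
  have bil: "bilinear g"
    using g by (simp add: left_invariant_metric_def)
  have bilbr: "bilinear br" and alt: "\<And>x. br x x = 0"
    using lie by (auto simp: lie_bracket_def)
  note anti = lie_bracket_antisym[OF lie]
  have V': "basis_frame V" "br (V 1) (V 2) = 0" "br (V 1) (V 3) = 0" "br (V 2) (V 3) = 2 *\<^sub>R V 1"
    using V by (simp_all add: milnor_frame_heisenberg_iff[OF lie])
  have gV: "g (V 1) (V 1) = a 1" "g (V 2) (V 2) = a 2" "g (V 3) (V 3) = a 3"
    "g (V 1) (V 2) = 0" "g (V 1) (V 3) = 0" "g (V 2) (V 3) = 0"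
    "g (V 2) (V 1) = 0" "g (V 3) (V 1) = 0" "g (V 3) (V 2) = 0"
    using diag by (simp_all add: diagonal_in_def atLeastAtMost_1_3)
  have a: "a 1 > 0" "a 2 > 0" "a 3 > 0"
    by (simp_all add: metric_diagonal_pos[OF g V'(1) diag])
  define co where "co i x = g x (V i) / a i" for i x
  have co_lin: "linear (co i)" for i
    by (rule linearI) (simp_all add: co_def bilinear_simps[OF bil] add_divide_distrib)
  have coV: "co 1 (V 1) = 1" "co 1 (V 2) = 0" "co 1 (V 3) = 0"
    "co 2 (V 1) = 0" "co 2 (V 2) = 1" "co 2 (V 3) = 0"
    "co 3 (V 1) = 0" "co 3 (V 2) = 0" "co 3 (V 3) = 1"
    using a by (simp_all add: co_def gV)
  have co_simps: "co i (x + y) = co i x + co i y" "co i (x - y) = co i x - co i y"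
    "co i (c *\<^sub>R x) = c * co i x" "co i 0 = 0" "co i (- x) = - co i x" for i x y c
    using co_lin[of i] by (simp_all add: linear_add linear_diff linear_cmul linear_0 linear_neg)
  have expand: "x = co 1 x *\<^sub>R V 1 + co 2 x *\<^sub>R V 2 + co 3 x *\<^sub>R V 3" for x
  proof -
    obtain p q r where "x = p *\<^sub>R V 1 + q *\<^sub>R V 2 + r *\<^sub>R V 3"
      using basis_frame_expansion[OF V'(1)] .
    then show ?thesis by (simp add: co_simps coV)
  qed
  have g_eq: "g x y = a 1 * (co 1 x * co 1 y) + a 2 * (co 2 x * co 2 y) + a 3 * (co 3 x * co 3 y)" for x y
    by (subst expand[of x], subst expand[of y]) (simp add: bilinear_simps[OF bil] gV algebra_simps)
  have br_eq: "br x y = (2 * (co 2 x * co 3 y - co 3 x * co 2 y)) *\<^sub>R V 1" for x y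
    by (subst expand[of x], subst expand[of y])
      (simp add: bilinear_simps[OF bilbr] V' alt anti[of "V 2" "V 1"] anti[of "V 3" "V 1"]
        anti[of "V 3" "V 2"] algebra_simps)
  \<comment> \<open>The Koszul formula evaluated on the frame: the nonzero products are
    \<open>N V\<^sub>2 V\<^sub>3 = V\<^sub>1 = - N V\<^sub>3 V\<^sub>2\<close>, \<open>N V\<^sub>1 V\<^sub>3 = N V\<^sub>3 V\<^sub>1 = (a\<^sub>1 / a\<^sub>2) V\<^sub>2\<close> and
    \<open>N V\<^sub>1 V\<^sub>2 = N V\<^sub>2 V\<^sub>1 = - (a\<^sub>1 / a\<^sub>3) V\<^sub>3\<close>.\<close>
  define N where "N x y = (co 2 x * co 3 y - co 3 x * co 2 y) *\<^sub>R V 1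
    + (a 1 / a 2 * (co 1 x * co 3 y + co 3 x * co 1 y)) *\<^sub>R V 2
    - (a 1 / a 3 * (co 1 x * co 2 y + co 2 x * co 1 y)) *\<^sub>R V 3" for x y
  have coN: "co 1 (N x y) = co 2 x * co 3 y - co 3 x * co 2 y"
    "co 2 (N x y) = a 1 / a 2 * (co 1 x * co 3 y + co 3 x * co 1 y)"
    "co 3 (N x y) = - (a 1 / a 3 * (co 1 x * co 2 y + co 2 x * co 1 y))" for x y
    by (simp_all add: N_def co_simps coV)
  have bilN: "bilinear N"
    unfolding bilinear_def
    by (intro conjI allI linearI; simp add: N_def co_simps algebra_simps add_divide_distrib)
  have "is_levi_civita br g N"
    unfolding is_levi_civita_def
  proof (intro conjI allI bilN)
    fix x y z
    show "N x y - N y x = br x y"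
      by (simp add: N_def br_eq algebra_simps flip: scaleR_add_left)
    show "g (N x y) z + g y (N x z) = 0"
      using a by (simp add: g_eq coN field_simps)
  qed
  then have LC: "levi_civita br g = N"
    using g by (rule levi_civita_eq)
  have riem: "riemann br g x y z = N x (N y z) - N y (N x z) - N (br x y) z" for x y z
    by (simp add: riemann_def LC)
  have "linear (\<lambda>x. riemann br g x y z)"
    by (rule linearI) (simp_all add: riem bilinear_simps[OF bilN] bilinear_simps[OF bilbr] algebra_simps)
  moreover have "x = (\<Sum>i\<in>{1, 2, 3::nat}. co i x *\<^sub>R V i)" for x
    using expand[of x] by (simp add: add.assoc)
  ultimately have "ricci br g y z = (\<Sum>i\<in>{1, 2, 3::nat}. co i (riemann br g (V i) y z))"
    unfolding ricci_def using co_lin by (intro endo_trace_eq_sum) auto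
  also have "\<dots> = 2 * a 1 / (a 2 * a 3) *
      (a 1 * (co 1 y * co 1 z) - a 2 * (co 2 y * co 2 z) - a 3 * (co 3 y * co 3 z))"
    using a by (simp add: riem co_simps coN br_eq coV) (simp add: field_simps)
  also have "\<dots> = 2 * a 1 / (a 2 * a 3) * (2 * g y (V 1) * g z (V 1) / g (V 1) (V 1) - g y z)"
    using a by (simp add: g_eq coV)
  finally show ?thesis .
qed

section \<open>Prescribing the Ricci curvature\<close>

text \<open>
  The frame \<open>V\<close> is arbitrary here, not adapted to \<open>g\<close>: only its central vector enters, and
  orthogonalising keeps that vector.
\<close>

lemma prescribed_ricci_normal_form:
  assumes lie: "lie_bracket br" and V: "milnor_frame br heisenberg_constants V"
    and ric: "prescribed_ricci br T g c"
  shows "\<exists>r>0. \<forall>x y. T x y = r * (2 * g x (V 1) * g y (V 1) / g (V 1) (V 1) - g x y)"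
proof -
  have g: "left_invariant_metric g" and c: "c > 0" and T: "\<And>x y. ricci br g x y = c * T x y"
    using ric by (auto simp: prescribed_ricci_def)
  obtain W a where W: "milnor_frame br heisenberg_constants W" "W 1 = V 1" "diagonal_in g W a"
    using orthogonal_milnor_frame[OF lie V g] .
  have basis: "basis_frame W"
    using W(1) by (simp add: milnor_frame_def)
  note pos = metric_diagonal_pos[OF g basis W(3)]
  define q where "q = 2 * a 1 / (a 2 * a 3)"
  have "c * T x y = q * (2 * g x (V 1) * g y (V 1) / g (V 1) (V 1) - g x y)" for x y
    using T[of x y] ricci_heisenberg[OF lie W(1) g W(3), of x y] W(2) by (simp add: q_def)
  then have "T x y = q / c * (2 * g x (V 1) * g y (V 1) / g (V 1) (V 1) - g x y)" for x y
    using c by (simp add: eq_divide_eq mult.commute)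
  moreover have "q / c > 0" using pos c by (simp add: q_def)
  ultimately show ?thesis by blast
qed

lemma prescribed_ricci_diagonal:
  assumes lie: "lie_bracket br" and V: "milnor_frame br heisenberg_constants V"
    and ric: "prescribed_ricci br T g c"
  shows "\<exists>W t. milnor_frame br heisenberg_constants W \<and> diagonal_in T W t \<and>
    t 1 > 0 \<and> t 2 < 0 \<and> t 3 < 0"
proof -
  have g: "left_invariant_metric g"
    using ric by (auto simp: prescribed_ricci_def)
  obtain W a where W: "milnor_frame br heisenberg_constants W" "diagonal_in g W a"
    using orthogonal_milnor_frame[OF lie V g] .
  have basis: "basis_frame W"
    using W(1) by (simp add: milnor_frame_def)
  have pos: "a 1 > 0" "a 2 > 0" "a 3 > 0"
    by (simp_all add: metric_diagonal_pos[OF g basis W(2)])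
  have gW: "g (W 1) (W 1) = a 1" "g (W 2) (W 2) = a 2" "g (W 3) (W 3) = a 3"
    "g (W 1) (W 2) = 0" "g (W 1) (W 3) = 0" "g (W 2) (W 3) = 0"
    "g (W 2) (W 1) = 0" "g (W 3) (W 1) = 0" "g (W 3) (W 2) = 0"
    using W(2) by (simp_all add: diagonal_in_def atLeastAtMost_1_3)
  obtain r where r: "r > 0"
    "\<And>x y. T x y = r * (2 * g x (W 1) * g y (W 1) / g (W 1) (W 1) - g x y)"
    using prescribed_ricci_normal_form[OF lie W(1) ric] by blast
  have "diagonal_in T W (\<lambda>i. T (W i) (W i))"
    using pos by (simp add: diagonal_in_def atLeastAtMost_1_3 r(2) gW)
  moreover have "T (W 1) (W 1) > 0" "T (W 2) (W 2) < 0" "T (W 3) (W 3) < 0"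
    using pos r(1) by (simp_all add: r(2) gW)
  ultimately show ?thesis using W(1) by blast
qed

text \<open>
  The solution is \<open>diag(t 1, - t 2, - t 3)\<close>, obtained from \<open>T\<close> by reversing its sign on the
  \<open>T\<close>-orthogonal complement of \<open>V 1\<close>. The curvature formula reverses the sign back, and its
  factor is the constant \<open>c = 2 t 1 / (t 2 t 3)\<close>.
\<close>

lemma diagonal_prescribed_ricci:
  assumes lie: "lie_bracket br" and T: "bilinear T"
    and V: "milnor_frame br heisenberg_constants V" and diag: "diagonal_in T V t"
    and t: "t 1 > 0" "t 2 < 0" "t 3 < 0"
  shows "\<exists>g c. prescribed_ricci br T g c"
proof -
  have basis: "basis_frame V"
    using V by (simp add: milnor_frame_def)
  have TV: "T (V 1) (V 1) = t 1" "T (V 2) (V 2) = t 2" "T (V 3) (V 3) = t 3"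
    "T (V 1) (V 2) = 0" "T (V 1) (V 3) = 0" "T (V 2) (V 3) = 0"
    "T (V 2) (V 1) = 0" "T (V 3) (V 1) = 0" "T (V 3) (V 2) = 0"
    using diag by (simp_all add: diagonal_in_def atLeastAtMost_1_3)
  define g where "g x y = 2 * T x (V 1) * T y (V 1) / T (V 1) (V 1) - T x y" for x y
  have "bilinear g"
    unfolding bilinear_def
    by (intro conjI allI linearI;
        simp add: g_def bilinear_simps[OF T] algebra_simps add_divide_distrib)
  moreover have "g x y = g y x" for x y
  proof -
    obtain p q r where x: "x = p *\<^sub>R V 1 + q *\<^sub>R V 2 + r *\<^sub>R V 3"
      using basis_frame_expansion[OF basis] .
    obtain p' q' r' where y: "y = p' *\<^sub>R V 1 + q' *\<^sub>R V 2 + r' *\<^sub>R V 3"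
      using basis_frame_expansion[OF basis] .
    show ?thesis by (simp add: g_def x y bilinear_simps[OF T] TV algebra_simps)
  qed
  moreover have "g x x > 0" if "x \<noteq> 0" for x
  proof -
    obtain p q r where x: "x = p *\<^sub>R V 1 + q *\<^sub>R V 2 + r *\<^sub>R V 3"
      using basis_frame_expansion[OF basis] .
    have "g x x = t 1 * p\<^sup>2 + (- t 2) * q\<^sup>2 + (- t 3) * r\<^sup>2"
      using t by (simp add: g_def x bilinear_simps[OF T] TV power2_eq_square field_simps)
    moreover have "t 1 * p\<^sup>2 \<ge> 0" "(- t 2) * q\<^sup>2 \<ge> 0" "(- t 3) * r\<^sup>2 \<ge> 0"
      using t by (intro mult_nonneg_nonneg; simp)+
    moreover have "t 1 * p\<^sup>2 > 0 \<or> (- t 2) * q\<^sup>2 > 0 \<or> (- t 3) * r\<^sup>2 > 0"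
    proof -
      have "p \<noteq> 0 \<or> q \<noteq> 0 \<or> r \<noteq> 0" using that x by auto
      then show ?thesis using t by (auto intro: mult_pos_pos mult_neg_pos)
    qed
    ultimately show ?thesis by linarith
  qed
  ultimately have g: "left_invariant_metric g"
    by (simp add: left_invariant_metric_def)
  have gdiag: "diagonal_in g V (\<lambda>i. g (V i) (V i))"
    by (simp add: diagonal_in_def atLeastAtMost_1_3 g_def TV)
  have "2 * g x (V 1) * g y (V 1) / g (V 1) (V 1) - g x y = T x y" for x y
    using t by (simp add: g_def TV field_simps)
  then have "ricci br g x y = 2 * t 1 / (t 2 * t 3) * T x y" for x y
    using t by (simp add: ricci_heisenberg[OF lie V g gdiag]) (simp add: g_def TV)
  moreover have "2 * t 1 / (t 2 * t 3) > 0"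
    using t by (simp add: mult_neg_neg)
  ultimately have "prescribed_ricci br T g (2 * t 1 / (t 2 * t 3))"
    using g by (simp add: prescribed_ricci_def)
  then show ?thesis by blast
qed

text \<open>
  Inverting the normal form expresses every solution as a positive multiple of one bilinear form
  that depends on \<open>T\<close> and \<open>z\<close> alone, so two solutions are proportional and hence have the same Ricci
  form; their constants agree because \<open>T\<close> does not vanish at \<open>z\<close>.
\<close>

lemma prescribed_ricci_unique:
  assumes heis: "heisenberg_lie_algebra br"
    and ric: "prescribed_ricci br T g c" and ric': "prescribed_ricci br T g' c'"
  shows "c' = c \<and> (\<exists>s>0. \<forall>x y. g' x y = s * g x y)"
proof -
  obtain V where lie: "lie_bracket br" and V: "milnor_frame br heisenberg_constants V"
    using heis by (auto simp: heisenberg_lie_algebra_def)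
  let ?z = "V 1"
  have determined: "\<exists>r>0. T ?z ?z > 0 \<and>
      (\<forall>x y. h x y = (2 * T x ?z * T y ?z / T ?z ?z - T x y) / r)"
    if h: "prescribed_ricci br T h d" for h d
  proof -
    have z: "h ?z ?z > 0"
      using h V by (auto simp: prescribed_ricci_def left_invariant_metric_def milnor_frame_def
          basis_frame_nonzero)
    obtain r where r: "r > 0"
      and T: "\<And>x y. T x y = r * (2 * h x ?z * h y ?z / h ?z ?z - h x y)"
      using prescribed_ricci_normal_form[OF lie V h] by blast
    have Tz: "T x ?z = r * h x ?z" for x
      using z by (simp add: T)
    have "(2 * T x ?z * T y ?z / T ?z ?z - T x y) / r = h x y" for x y
      using r z by (simp add: Tz) (simp add: T field_simps)
    then show ?thesis using r z Tz[of ?z] by (metis mult_pos_pos)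
  qed
  obtain r where r: "r > 0" "T ?z ?z > 0"
    "\<And>x y. g x y = (2 * T x ?z * T y ?z / T ?z ?z - T x y) / r"
    using determined[OF ric] by auto
  obtain r' where r': "r' > 0"
    "\<And>x y. g' x y = (2 * T x ?z * T y ?z / T ?z ?z - T x y) / r'"
    using determined[OF ric'] by auto
  let ?s = "r / r'"
  have s: "?s > 0" using r(1) r'(1) by simp
  have g': "g' x y = ?s * g x y" for x y
    using r(1) r'(1) by (simp add: r(3) r'(2))
  then have "g' = (\<lambda>x y. ?s * g x y)"
    by (intro ext)
  then have "ricci br g' = ricci br g"
    using ricci_scale[of ?s br g] s by (metis less_irrefl)
  then have "c' * T ?z ?z = c * T ?z ?z"
    using ric ric' by (metis prescribed_ricci_def)
  then have "c' = c" using r(2) by simp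
  with s g' show ?thesis by blast
qed

theorem theorem6p3:
  fixes br :: "'a::real_vector \<Rightarrow> 'a \<Rightarrow> 'a"
    and T :: "'a \<Rightarrow> 'a \<Rightarrow> real"
  assumes "heisenberg_lie_algebra br"
    and "bilinear T"
  shows "((\<exists>g c. prescribed_ricci br T g c) \<longleftrightarrow>
          (\<exists>V t. milnor_frame br heisenberg_constants V \<and> diagonal_in T V t \<and>
                 t 1 > 0 \<and> t 2 < 0 \<and> t 3 < 0)) \<and>
         (\<forall>g c g' c'. prescribed_ricci br T g c \<and> prescribed_ricci br T g' c' \<longrightarrow>
            c' = c \<and> (\<exists>s>0. \<forall>x y. g' x y = s * g x y))"
proof -
  have lie: "lie_bracket br" and frame: "\<exists>V. milnor_frame br heisenberg_constants V"
    using assms(1) by (auto simp: heisenberg_lie_algebra_def)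
  show ?thesis
    using prescribed_ricci_diagonal[OF lie] frame diagonal_prescribed_ricci[OF lie assms(2)]
      prescribed_ricci_unique[OF assms(1)]
    by (intro conjI iffI allI impI) blast+
qed

end
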